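(* The set $\{E^*_{\mathbf a}A_{\mathbf b}E^*_{\mathbf c}:(\mathbf a,\mathbf b,\mathbf c)\in\mathbb{P}\}$ is an $\mathbb{F}$-basis of $\mathbb{T}$, and it has cardinality $2^{2n_1}5^{n_2}$.
   Context: Let $\mathbb{F}$ be a field. Let $n\ge 1$ and let $U_1,\dots,U_n$ be finite sets with $|U_h|\ge 2$. Put $X=U_1\times\cdots\times U_n$ and $E=\{0,1\}^n$. For $\mathbf g\in E$ let $S(\mathbf g)=\{a:\mathbf g_a=1\}$. For $V\subseteq\{1,\dots,n\}$ let $V^\circ=\{a\in V:|U_a|>2\}$. Let $R_{\mathbf g}=\{(\mathbf y,\mathbf z)\in X\times X:\ \mathbf y_a\neq\mathbf z_a\iff\mathbf g_a=1\}$ (the factorial scheme). Let $A_{\mathbf g}\in\mathrm{M}_X(\mathbb{F})$ be the $\{0,1\}$ adjacency matrix of $R_{\mathbf g}$. Fix $\mathbf x\in X$ and let $E^*_{\mathbf g}$ be the diagonal matrix with $(\mathbf y,\mathbf y)$-entry $1$ iff $(\mathbf x,\mathbf y)\in R_{\mathbf g}$, else $0$. $\mathbb{T}$ is the $\mathbb{F}$-subalgebra of $\mathrm{M}_X(\mathbb{F})$ generated by all $A_{\mathbf g},E^*_{\mathbf g}$. Let $n_1=|\{a:|U_a|=2\}|$, $n_2=|\{a:|U_a|>2\}|$. Let $\mathbb{P}$ be the set of $(\mathbf a,\mathbf b,\mathbf c)\in E^3$ with $S(\mathbf a)\triangle S(\mathbf c)\subseteq S(\mathbf b)\subseteq(S(\mathbf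 a)\triangle S(\mathbf c))\cup(S(\mathbf a)\cap S(\mathbf c))^\circ$. *)

theory Defs
  imports Complex_Main "HOL-Library.FuncSet" "HOL-Library.Function_Algebras"
begin

text \<open>
  A matrix with rows and columns indexed by a finite set \<open>X\<close> is a function
  \<open>'x \<Rightarrow> 'x \<Rightarrow> 'f\<close> that vanishes outside \<open>X \<times> X\<close>. Addition and zero are the pointwise
  ones of \<^theory>\<open>HOL-Library.Function_Algebras\<close>; the pointwise \<open>*\<close> from there is
  not the matrix product and is not used on matrices.
\<close>

definition mat_carrier :: "'x set \<Rightarrow> ('x \<Rightarrow> 'x \<Rightarrow> 'f::field) set" where
  "mat_carrier X = {M. \<forall>y z. (y, z) \<notin> X \<times> X \<longrightarrow> M y z = 0}"

definition mat_scale :: "'f::field \<Rightarrow> ('x \<Rightarrow> 'x \<Rightarrow> 'f) \<Rightarrow> 'x \<Rightarrow> 'x \<Rightarrow> 'f" where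
  "mat_scale c M = (\<lambda>y z. c * M y z)"

definition mat_mult ::
  "'x set \<Rightarrow> ('x \<Rightarrow> 'x \<Rightarrow> 'f::field) \<Rightarrow> ('x \<Rightarrow> 'x \<Rightarrow> 'f) \<Rightarrow> 'x \<Rightarrow> 'x \<Rightarrow> 'f" where
  "mat_mult X M N = (\<lambda>y z. \<Sum>w\<in>X. M y w * N w z)"

definition mat_one :: "'x set \<Rightarrow> 'x \<Rightarrow> 'x \<Rightarrow> 'f::field" where
  "mat_one X = (\<lambda>y z. if y \<in> X \<and> z = y then 1 else 0)"

global_interpretation mat: vector_space "mat_scale :: 'f::field \<Rightarrow> ('x \<Rightarrow> 'x \<Rightarrow> 'f) \<Rightarrow> _"
  by unfold_locales (auto simp: mat_scale_def fun_eq_iff algebra_simps)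

definition mat_subalgebra :: "'x set \<Rightarrow> ('x \<Rightarrow> 'x \<Rightarrow> 'f::field) set \<Rightarrow> bool" where
  "mat_subalgebra X B \<longleftrightarrow>
     B \<subseteq> mat_carrier X \<and> mat.subspace B \<and> mat_one X \<in> B \<and>
     (\<forall>M\<in>B. \<forall>N\<in>B. mat_mult X M N \<in> B)"

definition mat_basis :: "('x \<Rightarrow> 'x \<Rightarrow> 'f::field) set \<Rightarrow> ('x \<Rightarrow> 'x \<Rightarrow> 'f) set \<Rightarrow> bool" where
  "mat_basis B V \<longleftrightarrow> mat.independent B \<and> mat.span B = V"

lemma mat_subalgebra_carrier: "mat_subalgebra X (mat_carrier X)"
  unfolding mat_subalgebra_def mat.subspace_def
  by (auto simp: mat_carrier_def mat_scale_def mat_mult_def mat_one_def)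

definition fs_points :: "nat \<Rightarrow> (nat \<Rightarrow> 'u set) \<Rightarrow> (nat \<Rightarrow> 'u) set" where
  "fs_points n U = (\<Pi>\<^sub>E h\<in>{1..n}. U h)"

definition fs_index :: "nat \<Rightarrow> (nat \<Rightarrow> nat) set" where
  "fs_index n = (\<Pi>\<^sub>E h\<in>{1..n}. {0, 1})"

definition fs_supp :: "nat \<Rightarrow> (nat \<Rightarrow> nat) \<Rightarrow> nat set" where
  "fs_supp n g = {a \<in> {1..n}. g a = 1}"

definition fs_circ :: "(nat \<Rightarrow> 'u set) \<Rightarrow> nat set \<Rightarrow> nat set" where
  "fs_circ U V = {a \<in> V. card (U a) > 2}"

definition fs_rel ::
  "nat \<Rightarrow> (nat \<Rightarrow> 'u set) \<Rightarrow> (nat \<Rightarrow> nat) \<Rightarrow> ((nat \<Rightarrow> 'u) \<times> (nat \<Rightarrow> 'u)) set" where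
  "fs_rel n U g =
     {(y, z) \<in> fs_points n U \<times> fs_points n U. \<forall>a\<in>{1..n}. y a \<noteq> z a \<longleftrightarrow> g a = 1}"

definition fs_adj ::
  "nat \<Rightarrow> (nat \<Rightarrow> 'u set) \<Rightarrow> (nat \<Rightarrow> nat) \<Rightarrow> (nat \<Rightarrow> 'u) \<Rightarrow> (nat \<Rightarrow> 'u) \<Rightarrow> 'f::field" where
  "fs_adj n U g = (\<lambda>y z. if (y, z) \<in> fs_rel n U g then 1 else 0)"

definition fs_dual_idem ::
  "nat \<Rightarrow> (nat \<Rightarrow> 'u set) \<Rightarrow> (nat \<Rightarrow> 'u) \<Rightarrow> (nat \<Rightarrow> nat) \<Rightarrow>
     (nat \<Rightarrow> 'u) \<Rightarrow> (nat \<Rightarrow> 'u) \<Rightarrow> 'f::field" where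
  "fs_dual_idem n U x g = (\<lambda>y z. if y = z \<and> (x, y) \<in> fs_rel n U g then 1 else 0)"

definition fs_terwilliger ::
  "nat \<Rightarrow> (nat \<Rightarrow> 'u set) \<Rightarrow> (nat \<Rightarrow> 'u) \<Rightarrow> ((nat \<Rightarrow> 'u) \<Rightarrow> (nat \<Rightarrow> 'u) \<Rightarrow> 'f::field) set" where
  "fs_terwilliger n U x =
     mat_subalgebra (fs_points n U) hull
       (fs_adj n U ` fs_index n \<union> fs_dual_idem n U x ` fs_index n)"

definition fs_triples ::
  "nat \<Rightarrow> (nat \<Rightarrow> 'u set) \<Rightarrow> ((nat \<Rightarrow> nat) \<times> (nat \<Rightarrow> nat) \<times> (nat \<Rightarrow> nat)) set" where
  "fs_triples n U =
     {(a, b, c) \<in> fs_index n \<times> fs_index n \<times> fs_index n.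
        sym_diff (fs_supp n a) (fs_supp n c) \<subseteq> fs_supp n b \<and>
        fs_supp n b \<subseteq> sym_diff (fs_supp n a) (fs_supp n c) \<union>
                          fs_circ U (fs_supp n a \<inter> fs_supp n c)}"

definition fs_triple_products ::
  "nat \<Rightarrow> (nat \<Rightarrow> 'u set) \<Rightarrow> (nat \<Rightarrow> 'u) \<Rightarrow> ((nat \<Rightarrow> 'u) \<Rightarrow> (nat \<Rightarrow> 'u) \<Rightarrow> 'f::field) set" where
  "fs_triple_products n U x =
     {mat_mult (fs_points n U)
        (mat_mult (fs_points n U) (fs_dual_idem n U x a) (fs_adj n U b))
        (fs_dual_idem n U x c) | a b c. (a, b, c) \<in> fs_triples n U}"

end

theory Submission
  imports Defs "HOL-Combinatorics.Transposition"
begin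

text \<open>
  The triple product \<open>E*\<^sub>a A\<^sub>b E*\<^sub>c\<close> is the indicator matrix of the pairs \<open>(y, z)\<close> whose type,
  the triple of coordinatewise inequality patterns of \<open>(x, y)\<close>, \<open>(y, z)\<close>, \<open>(x, z)\<close>, is
  \<open>(a, b, c)\<close>. The types that occur are exactly the triples in \<open>fs_triples\<close>, so these matrices are
  nonzero with disjoint supports, and they span the space of matrices that depend only on the type.
  Two pairs of the same type are related by a product of coordinatewise permutations fixing \<open>x\<close>.
  Such permutations preserve types, so this space is closed under multiplication and therefore
  equals the Terwilliger algebra. Types are chosen independently in each coordinate, with four
  choices if \<open>|U\<^sub>h| = 2\<close> and five if \<open>|U\<^sub>h| > 2\<close>.
\<close>

section \<open>Inequality patterns and types of pairs\<close>

definition bit_neq :: "'u \<Rightarrow> 'u \<Rightarrow> nat" where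
  "bit_neq u v = (if u \<noteq> v then 1 else 0)"

text \<open>The restriction makes the value an element of \<open>fs_index n\<close>. For points
  \<open>y\<close> and \<open>z\<close> of the scheme it is the unique index \<open>g\<close> with
  \<open>(y, z)\<close> in \<open>fs_rel n U g\<close>.\<close>

definition pattern :: "nat \<Rightarrow> (nat \<Rightarrow> 'u) \<Rightarrow> (nat \<Rightarrow> 'u) \<Rightarrow> nat \<Rightarrow> nat" where
  "pattern n y z = (\<lambda>h\<in>{1..n}. bit_neq (y h) (z h))"

text \<open>The components are ordered like the factors of the triple product: row class of
  \<open>y\<close>, relation of \<open>y\<close> to \<open>z\<close>, column class of
  \<open>z\<close>.\<close>

definition pair_type ::
  "nat \<Rightarrow> (nat \<Rightarrow> 'u) \<Rightarrow> (nat \<Rightarrow> 'u) \<Rightarrow> (nat \<Rightarrow> 'u) \<Rightarrow>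
     (nat \<Rightarrow> nat) \<times> (nat \<Rightarrow> nat) \<times> (nat \<Rightarrow> nat)" where
  "pair_type n x y z = (pattern n x y, pattern n y z, pattern n x z)"

text \<open>These are the equality patterns of three elements \<open>p\<close>, \<open>u\<close>,
  \<open>v\<close> of \<open>W\<close>, encoded as bits for \<open>(p, u)\<close>,
  \<open>(u, v)\<close>, \<open>(p, v)\<close>. They correspond to the five partitions of a
  three-element set; the partition into singletons requires three distinct elements of
  \<open>W\<close>.\<close>

definition local_types :: "'u set \<Rightarrow> (nat \<times> nat \<times> nat) set" where
  "local_types W =
     {(0, 0, 0), (0, 1, 1), (1, 1, 0), (1, 0, 1)} \<union> (if card W > 2 then {(1, 1, 1)} else {})"

definition type_indicator ::
  "nat \<Rightarrow> (nat \<Rightarrow> 'u set) \<Rightarrow> (nat \<Rightarrow> 'u) \<Rightarrow> (nat \<Rightarrow> nat) \<times> (nat \<Rightarrow> nat) \<times> (nat \<Rightarrow> nat) \<Rightarrow>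
     (nat \<Rightarrow> 'u) \<Rightarrow> (nat \<Rightarrow> 'u) \<Rightarrow> 'f::field" where
  "type_indicator n U x t =
     (\<lambda>y z. if y \<in> fs_points n U \<and> z \<in> fs_points n U \<and> pair_type n x y z = t then 1 else 0)"

text \<open>Phrased entrywise rather than as a span, so that closure under multiplication can be
  checked on matrix entries. Under the hypotheses of the theorem it is the centralizer algebra of
  the product of the stabilizers of \<open>x h\<close> in the symmetric groups of the
  \<open>U h\<close>, whose orbits on pairs are the types.\<close>

definition type_invariant ::
  "nat \<Rightarrow> (nat \<Rightarrow> 'u set) \<Rightarrow> (nat \<Rightarrow> 'u) \<Rightarrow> ((nat \<Rightarrow> 'u) \<Rightarrow> (nat \<Rightarrow> 'u) \<Rightarrow> 'f::field) set" where
  "type_invariant n U x = {M \<in> mat_carrier (fs_points n U).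
     \<forall>y\<in>fs_points n U. \<forall>z\<in>fs_points n U. \<forall>y'\<in>fs_points n U. \<forall>z'\<in>fs_points n U.
       pair_type n x y z = pair_type n x y' z' \<longrightarrow> M y z = M y' z'}"

lemma bit_neq_eq_iff: "bit_neq u v = bit_neq u' v' \<longleftrightarrow> (u = v \<longleftrightarrow> u' = v')"
  by (auto simp: bit_neq_def)

lemma pattern_in_index: "pattern n y z \<in> fs_index n"
  by (auto simp: pattern_def fs_index_def bit_neq_def)

lemma pattern_eq_iff:
  "pattern n y z = pattern n y' z' \<longleftrightarrow> (\<forall>h\<in>{1..n}. y h = z h \<longleftrightarrow> y' h = z' h)"
proof
  assume eq: "pattern n y z = pattern n y' z'"
  show "\<forall>h\<in>{1..n}. y h = z h \<longleftrightarrow> y' h = z' h"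
  proof
    fix h assume "h \<in> {1..n}"
    with fun_cong[OF eq, of h] show "y h = z h \<longleftrightarrow> y' h = z' h"
      by (simp add: pattern_def bit_neq_eq_iff)
  qed
next
  assume "\<forall>h\<in>{1..n}. y h = z h \<longleftrightarrow> y' h = z' h"
  then show "pattern n y z = pattern n y' z'"
    unfolding pattern_def by (intro restrict_ext) (simp add: bit_neq_eq_iff)
qed

text \<open>An index is determined by the places where it is 1: elsewhere in \<open>{1..n}\<close>
  it is 0, and outside that set it is \<open>undefined\<close>, just as the restricted function
  \<open>pattern n y z\<close> is.\<close>

lemma pattern_cong_iff:
  assumes "g \<in> fs_index n"
  shows "pattern n y z = g \<longleftrightarrow> (\<forall>h\<in>{1..n}. y h \<noteq> z h \<longleftrightarrow> g h = 1)"
proof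
  assume *: "\<forall>h\<in>{1..n}. y h \<noteq> z h \<longleftrightarrow> g h = 1"
  show "pattern n y z = g"
  proof
    fix h
    show "pattern n y z h = g h"
    proof (cases "h \<in> {1..n}")
      case True
      with assms have "g h \<in> {0, 1}" by (auto simp: fs_index_def)
      with True * show ?thesis by (auto simp: pattern_def bit_neq_def)
    next
      case False
      have "g h = undefined" using assms False unfolding fs_index_def by (rule PiE_arb)
      moreover have "pattern n y z h = undefined"
        unfolding pattern_def restrict_def using False by (rule if_not_P)
      ultimately show ?thesis by simp
    qed
  qed
next
  assume "pattern n y z = g"
  then show "\<forall>h\<in>{1..n}. y h \<noteq> z h \<longleftrightarrow> g h = 1"
    by (auto simp: pattern_def bit_neq_def)
qed

lemma fs_rel_iff:
  assumes "g \<in> fs_index n"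
  shows "(y, z) \<in> fs_rel n U g \<longleftrightarrow>
    y \<in> fs_points n U \<and> z \<in> fs_points n U \<and> pattern n y z = g"
  unfolding fs_rel_def pattern_cong_iff[OF assms] by blast

lemma fs_points_eq_iff:
  assumes "y \<in> fs_points n U" "z \<in> fs_points n U"
  shows "y = z \<longleftrightarrow> (\<forall>h\<in>{1..n}. y h = z h)"
  using PiE_ext[of y "{1..n}" U z] assms unfolding fs_points_def by blast

text \<open>Inclusions between subsets of \<open>{1..n}\<close> can be tested index by index. Where
  \<open>a h\<close> and \<open>c h\<close> differ, \<open>b h\<close> must be 1; where both are 0,
  \<open>b h\<close> must be 0; where both are 1, \<open>b h\<close> is free if
  \<open>card (U h) > 2\<close> and is 0 otherwise.\<close>

lemma fs_triples_iff:
  "(a, b, c) \<in> fs_triples n U \<longleftrightarrow>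
    a \<in> fs_index n \<and> b \<in> fs_index n \<and> c \<in> fs_index n \<and>
    (\<forall>h\<in>{1..n}. (a h, b h, c h) \<in> local_types (U h))"
proof (cases "a \<in> fs_index n \<and> b \<in> fs_index n \<and> c \<in> fs_index n")
  case True
  have bits: "a h \<in> {0, 1} \<and> b h \<in> {0, 1} \<and> c h \<in> {0, 1}" if "h \<in> {1..n}" for h
    using True that by (auto simp: fs_index_def)
  have loc: "(a h, b h, c h) \<in> local_types (U h) \<longleftrightarrow>
      ((a h = 1) \<noteq> (c h = 1) \<longrightarrow> b h = 1) \<and>
      (b h = 1 \<longrightarrow> (a h = 1) \<noteq> (c h = 1) \<or> a h = 1 \<and> c h = 1 \<and> card (U h) > 2)"
    if "h \<in> {1..n}" for h
    using bits[OF that] by (auto simp: local_types_def)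
  have "(a, b, c) \<in> fs_triples n U \<longleftrightarrow>
      (\<forall>h\<in>{1..n}. ((a h = 1) \<noteq> (c h = 1) \<longrightarrow> b h = 1) \<and>
        (b h = 1 \<longrightarrow> (a h = 1) \<noteq> (c h = 1) \<or> a h = 1 \<and> c h = 1 \<and> card (U h) > 2))"
    using True unfolding fs_triples_def fs_supp_def fs_circ_def by blast
  with loc True show ?thesis by simp
qed (auto simp: fs_triples_def)

section \<open>Types and point-fixing permutations in a single coordinate\<close>

lemma bit_types_in_local_types:
  assumes "finite W" "card W \<ge> 2" "p \<in> W" "u \<in> W" "v \<in> W"
  shows "(bit_neq p u, bit_neq u v, bit_neq p v) \<in> local_types W"
proof -
  have "card W > 2" if "p \<noteq> u" "u \<noteq> v" "p \<noteq> v"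
    using card_mono[of W "{p, u, v}"] assms that by simp
  then show ?thesis by (auto simp: local_types_def bit_neq_def)
qed

text \<open>With \<open>p\<close> prescribed, \<open>u\<close> and \<open>v\<close> can be taken
  from \<open>p\<close> and one further element \<open>q\<close>, except that
  \<open>(1, 1, 1)\<close> calls for a third element \<open>r\<close>, available because that type
  lies in \<open>local_types W\<close> only if \<open>card W > 2\<close>.\<close>

lemma local_types_realized:
  assumes "finite W" "card W \<ge> 2" "p \<in> W" "t \<in> local_types W"
  shows "\<exists>u\<in>W. \<exists>v\<in>W. (bit_neq p u, bit_neq u v, bit_neq p v) = t"
proof -
  have "card (W - {p}) \<ge> 1" using assms by simp
  then have "W - {p} \<noteq> {}" by (metis card.empty not_one_le_zero)
  then obtain q where q: "q \<in> W" "q \<noteq> p" by blast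
  show ?thesis
  proof (cases "t = (1, 1, 1)")
    case True
    then have "card W > 2" using assms(4) by (auto simp: local_types_def split: if_splits)
    then have "card (W - {p, q}) \<ge> 1" using assms q by (simp add: card_Diff_subset)
    then have "W - {p, q} \<noteq> {}" by (metis card.empty not_one_le_zero)
    then obtain r where "r \<in> W" "r \<noteq> p" "r \<noteq> q" by blast
    with q True show ?thesis by (auto simp: bit_neq_def)
  next
    case False
    with assms(4) have "t \<in> {(0, 0, 0), (0, 1, 1), (1, 1, 0), (1, 0, 1)}"
      by (auto simp: local_types_def split: if_splits)
    then consider "t = (0, 0, 0)" | "t = (0, 1, 1)" | "t = (1, 1, 0)" | "t = (1, 0, 1)"
      by blast
    then show ?thesis
    proof cases
      case 1 with \<open>p \<in> W\<close> show ?thesis by (intro bexI[of _ p]) (auto simp: bit_neq_def)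
    next
      case 2 with \<open>p \<in> W\<close> q show ?thesis
        by (intro bexI[of _ p] bexI[of _ q]) (auto simp: bit_neq_def)
    next
      case 3 with \<open>p \<in> W\<close> q show ?thesis
        by (intro bexI[of _ q] bexI[of _ p]) (auto simp: bit_neq_def)
    next
      case 4 with q show ?thesis
        by (intro bexI[of _ q]) (auto simp: bit_neq_def)
    qed
  qed
qed

text \<open>Two transpositions suffice: \<open>s\<close> moves \<open>u\<close> to
  \<open>u'\<close>, then a second one moves \<open>s v\<close> to \<open>v'\<close>. The first
  fixes \<open>p\<close> because \<open>p\<close> is either equal to both of \<open>u\<close>,
  \<open>u'\<close> or to neither. The second fixes \<open>p\<close> and \<open>u'\<close> for the
  same reason, since injectivity of \<open>s\<close> turns a coincidence with \<open>s v\<close>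
  into one with \<open>v\<close>.\<close>

lemma permutation_fixing_point_exists:
  assumes "p \<in> W" "u \<in> W" "v \<in> W" "u' \<in> W" "v' \<in> W"
    and "p = u \<longleftrightarrow> p = u'" "u = v \<longleftrightarrow> u' = v'" "p = v \<longleftrightarrow> p = v'"
  shows "\<exists>f. bij_betw f W W \<and> f p = p \<and> f u = u' \<and> f v = v'"
proof -
  define s where "s = transpose u u'"
  define f where "f = transpose (s v) v' \<circ> s"
  have sW: "bij_betw s W W" using assms(2,4) by (simp add: s_def)
  then have "s v \<in> W" using assms(3) by (auto simp: bij_betw_def)
  then have "bij_betw f W W"
    unfolding f_def using assms(5) by (intro bij_betw_trans[OF sW]) simp
  moreover have su: "s u = u'" and sp: "s p = p"
    using assms(6) by (auto simp: s_def transpose_def)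
  have eq_iff: "s a = s b \<longleftrightarrow> a = b" for a b
    using bij_is_inj[OF bij_transpose] by (auto simp: s_def inj_eq)
  have "f v = v'" by (simp add: f_def)
  moreover have "f p = p"
    using assms(8) eq_iff[of p v] by (auto simp: f_def sp transpose_def)
  moreover have "f u = u'"
    using assms(7) eq_iff[of u v] by (auto simp: f_def su transpose_def)
  ultimately show ?thesis by blast
qed

section \<open>Counting the admissible triples\<close>

lemma card_fs_triples:
  assumes "\<And>h. h \<in> {1..n} \<Longrightarrow> card (U h) \<ge> 2"
  shows "card (fs_triples n U) =
    2 ^ (2 * card {a \<in> {1..n}. card (U a) = 2}) * 5 ^ card {a \<in> {1..n}. card (U a) > 2}"
proof -
  \<comment> \<open>A triple of functions is repackaged by \<open>?f\<close> as one function with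
    values in triples, and \<open>?g\<close> undoes this. The restrictions keep everything
    extensional, so both round trips need comparing on \<open>{1..n}\<close> only.\<close>
  let ?L = "\<Pi>\<^sub>E h\<in>{1..n}. local_types (U h)"
  let ?f = "\<lambda>(a, b, c). \<lambda>h\<in>{1..n}. (a h, b h, c h)"
  let ?g = "\<lambda>t. (\<lambda>h\<in>{1..n}. fst (t h), \<lambda>h\<in>{1..n}. fst (snd (t h)), \<lambda>h\<in>{1..n}. snd (snd (t h)))"
  have bits: "fst s \<in> {0, 1} \<and> fst (snd s) \<in> {0, 1} \<and> snd (snd s) \<in> {0, 1}"
    if "s \<in> local_types W" for s and W :: "'a set"
    using that by (auto simp: local_types_def split: if_splits)
  have "bij_betw ?f (fs_triples n U) ?L"
  proof (rule bij_betw_byWitness[where f' = ?g])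
    show "\<forall>t\<in>fs_triples n U. ?g (?f t) = t"
    proof
      fix t assume t: "t \<in> fs_triples n U"
      obtain a b c where abc: "t = (a, b, c)" by (cases t)
      with t have "a \<in> extensional {1..n}" "b \<in> extensional {1..n}" "c \<in> extensional {1..n}"
        by (simp_all add: fs_triples_iff fs_index_def PiE_def)
      then show "?g (?f t) = t"
        unfolding abc prod.inject prod.case
        by (intro conjI extensionalityI[of _ "{1..n}"]) simp_all
    qed
    show "\<forall>t\<in>?L. ?f (?g t) = t"
    proof
      fix t assume "t \<in> ?L"
      then show "?f (?g t) = t"
        unfolding prod.case
        by (intro extensionalityI[of _ "{1..n}"]) (simp_all add: PiE_def)
    qed
    show "?f ` fs_triples n U \<subseteq> ?L"
      by (auto simp: fs_triples_iff)
    show "?g ` ?L \<subseteq> fs_triples n U"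
    proof
      fix s assume "s \<in> ?g ` ?L"
      then obtain t where t: "t \<in> ?L" and s: "s = ?g t" by blast
      have th: "t h \<in> local_types (U h)" if "h \<in> {1..n}" for h
        using t that by (rule PiE_mem)
      show "s \<in> fs_triples n U"
        unfolding s fs_triples_iff fs_index_def using th bits[OF th] by simp
    qed
  qed
  then have "card (fs_triples n U) = (\<Prod>h\<in>{1..n}. card (local_types (U h)))"
    by (simp add: bij_betw_same_card card_PiE)
  also have "\<dots> = (\<Prod>h\<in>{1..n}. if card (U h) = 2 then 4 else 5)"
    using assms by (intro prod.cong) (force simp: local_types_def)+
  also have "\<dots> = 4 ^ card {a \<in> {1..n}. card (U a) = 2} *
      5 ^ card {a \<in> {1..n}. card (U a) \<noteq> 2}"
    by (subst prod.If_cases) (auto intro!: arg_cong2[of _ _ _ _ "(*)"] arg_cong[of _ _ card])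
  \<comment> \<open>The bound \<open>card (U a) \<ge> 2\<close> turns being different from 2 into
    exceeding 2.\<close>
  also have "{a \<in> {1..n}. card (U a) \<noteq> 2} = {a \<in> {1..n}. card (U a) > 2}"
    using assms by force
  finally show ?thesis by (simp add: power_mult)
qed

section \<open>The types that occur in the scheme with base point\<close>

locale pointed_factorial_scheme =
  fixes n :: nat and U :: "nat \<Rightarrow> 'u set" and x :: "nat \<Rightarrow> 'u"
  assumes factor: "\<And>h. h \<in> {1..n} \<Longrightarrow> finite (U h) \<and> card (U h) \<ge> 2"
    and base: "x \<in> fs_points n U"
begin

abbreviation X :: "(nat \<Rightarrow> 'u) set" where "X \<equiv> fs_points n U"

lemma point_mem: "w \<in> X \<Longrightarrow> h \<in> {1..n} \<Longrightarrow> w h \<in> U h"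
  unfolding fs_points_def by (rule PiE_mem)

lemma finite_points: "finite X"
  using factor unfolding fs_points_def by (intro finite_PiE) auto

lemma finite_triples: "finite (fs_triples n U)"
proof (rule finite_subset)
  show "fs_triples n U \<subseteq> fs_index n \<times> fs_index n \<times> fs_index n"
    by (auto simp: fs_triples_def)
  have "finite (fs_index n)" unfolding fs_index_def by (intro finite_PiE) auto
  then show "finite (fs_index n \<times> fs_index n \<times> fs_index n)" by simp
qed

lemma pair_type_in_triples:
  assumes "y \<in> X" "z \<in> X"
  shows "pair_type n x y z \<in> fs_triples n U"
proof -
  have "(bit_neq (x h) (y h), bit_neq (y h) (z h), bit_neq (x h) (z h)) \<in> local_types (U h)"
    if "h \<in> {1..n}" for h
    using that assms base factor[OF that]
    by (intro bit_types_in_local_types point_mem) auto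
  then show ?thesis
    unfolding pair_type_def fs_triples_iff by (simp add: pattern_in_index) (simp add: pattern_def)
qed

text \<open>The point set is a full product, so witnesses chosen separately in each coordinate,
  relative to the base value \<open>x h\<close>, combine into two points.\<close>

lemma triples_realized:
  assumes "t \<in> fs_triples n U"
  shows "\<exists>y\<in>X. \<exists>z\<in>X. pair_type n x y z = t"
proof -
  obtain a b c where t: "t = (a, b, c)" by (cases t)
  have ind: "a \<in> fs_index n" "b \<in> fs_index n" "c \<in> fs_index n"
    and loc: "\<And>h. h \<in> {1..n} \<Longrightarrow> (a h, b h, c h) \<in> local_types (U h)"
    using assms unfolding t fs_triples_iff by blast+
  have "\<exists>u v. u \<in> U h \<and> v \<in> U h \<and> (bit_neq (x h) u, bit_neq u v, bit_neq (x h) v) = (a h, b h, c h)"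
    if "h \<in> {1..n}" for h
    using local_types_realized[OF _ _ point_mem[OF base that] loc[OF that]] factor[OF that]
    by blast
  then obtain u v where uv: "\<And>h. h \<in> {1..n} \<Longrightarrow> u h \<in> U h \<and> v h \<in> U h \<and>
      (bit_neq (x h) (u h), bit_neq (u h) (v h), bit_neq (x h) (v h)) = (a h, b h, c h)"
    by metis
  define y where "y = restrict u {1..n}"
  define z where "z = restrict v {1..n}"
  have "y \<in> X" "z \<in> X" using uv by (auto simp: y_def z_def fs_points_def)
  moreover have "pair_type n x y z = t"
  proof -
    have "(x h \<noteq> y h \<longleftrightarrow> a h = 1) \<and> (y h \<noteq> z h \<longleftrightarrow> b h = 1) \<and> (x h \<noteq> z h \<longleftrightarrow> c h = 1)"
      if "h \<in> {1..n}" for h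
      using uv[OF that] that by (auto simp: y_def z_def bit_neq_def split: if_splits)
    then show ?thesis
      unfolding pair_type_def t prod.inject
        pattern_cong_iff[OF ind(1)] pattern_cong_iff[OF ind(2)] pattern_cong_iff[OF ind(3)]
      by blast
  qed
  ultimately show ?thesis by blast
qed

section \<open>Triple products as indicator matrices, and their independence\<close>

lemma triple_product_eq_indicator:
  assumes "a \<in> fs_index n" "b \<in> fs_index n" "c \<in> fs_index n"
  shows "mat_mult X (mat_mult X (fs_dual_idem n U x a) (fs_adj n U b)) (fs_dual_idem n U x c) =
    type_indicator n U x (a, b, c)"
proof (intro ext)
  fix y z
  have left: "mat_mult X (fs_dual_idem n U x a) (fs_adj n U b) y w =
      (if (x, y) \<in> fs_rel n U a \<and> (y, w) \<in> fs_rel n U b then 1 else 0)" for w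
  proof -
    \<comment> \<open>The left factor is diagonal, so only the summand \<open>v = y\<close>
      survives.\<close>
    have "mat_mult X (fs_dual_idem n U x a) (fs_adj n U b) y w =
      (\<Sum>v\<in>X. if v = y then
        (if (x, y) \<in> fs_rel n U a \<and> (y, w) \<in> fs_rel n U b then 1 else 0) else 0)"
      unfolding mat_mult_def by (intro sum.cong) (auto simp: fs_dual_idem_def fs_adj_def)
    \<comment> \<open>The surviving summand is present only if \<open>y\<close> lies in the index
      set; a nonzero value ensures this.\<close>
    moreover have "y \<in> X" if "(x, y) \<in> fs_rel n U a"
      using that by (simp add: fs_rel_iff assms)
    ultimately show ?thesis using finite_points by auto
  qed
  have "mat_mult X (mat_mult X (fs_dual_idem n U x a) (fs_adj n U b)) (fs_dual_idem n U x c) y z =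
    (\<Sum>v\<in>X. if v = z then (if (x, y) \<in> fs_rel n U a \<and> (y, z) \<in> fs_rel n U b \<and>
        (x, z) \<in> fs_rel n U c then 1 else 0) else 0)"
    unfolding mat_mult_def[of _ "mat_mult _ _ _"] left
    by (intro sum.cong) (auto simp: fs_dual_idem_def)
  also have "\<dots> = type_indicator n U x (a, b, c) y z"
    using finite_points base
    by (auto simp: type_indicator_def pair_type_def fs_rel_iff assms)
  finally show "mat_mult X (mat_mult X (fs_dual_idem n U x a) (fs_adj n U b))
      (fs_dual_idem n U x c) y z = type_indicator n U x (a, b, c) y z" .
qed

lemma fs_triple_products_eq:
  "fs_triple_products n U x = type_indicator n U x ` fs_triples n U"
proof -
  have "mat_mult X (mat_mult X (fs_dual_idem n U x a) (fs_adj n U b)) (fs_dual_idem n U x c) =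
      type_indicator n U x (a, b, c)" if "(a, b, c) \<in> fs_triples n U" for a b c
    using that by (intro triple_product_eq_indicator) (auto simp: fs_triples_def)
  then show ?thesis
    unfolding fs_triple_products_def by (force simp: image_def)
qed

lemma type_indicator_at:
  assumes "y \<in> X" "z \<in> X"
  shows "type_indicator n U x t y z = (if pair_type n x y z = t then 1 else 0)"
  using assms by (simp add: type_indicator_def)

text \<open>At a pair realizing \<open>s\<close> the indicator of \<open>s\<close> is 1, and an
  equal indicator must belong to the type of that pair. Both the reindexing of sums over the
  products and their cardinality rest on this.\<close>

lemma inj_on_type_indicator:
  "inj_on (type_indicator n U x :: _ \<Rightarrow> _ \<Rightarrow> _ \<Rightarrow> 'f::field) (fs_triples n U)"
proof (rule inj_onI)
  fix s t
  assume s: "s \<in> fs_triples n U"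
    and eq: "(type_indicator n U x s :: _ \<Rightarrow> _ \<Rightarrow> 'f) = type_indicator n U x t"
  obtain y z where "y \<in> X" "z \<in> X" "pair_type n x y z = s" using triples_realized[OF s] by blast
  with fun_cong[OF fun_cong[OF eq, of y], of z] show "s = t"
    by (simp add: type_indicator_at split: if_splits)
qed

text \<open>Every pair has exactly one type, and that type is admissible, so a single summand
  contributes to each entry.\<close>

lemma sum_type_indicator_apply:
  assumes "y \<in> X" "z \<in> X"
  shows "(\<Sum>t\<in>fs_triples n U. mat_scale (r t) (type_indicator n U x t)) y z =
    r (pair_type n x y z)"
proof -
  have "(\<Sum>t\<in>S. mat_scale (r t) (type_indicator n U x t)) y z =
      (\<Sum>t\<in>S. r t * type_indicator n U x t y z)" for S
    by (induction S rule: infinite_finite_induct) (auto simp: mat_scale_def)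
  also have "(\<Sum>t\<in>fs_triples n U. r t * type_indicator n U x t y z) =
      (\<Sum>t\<in>fs_triples n U. if t = pair_type n x y z then r t else 0)"
    using assms by (intro sum.cong) (auto simp: type_indicator_at)
  also have "\<dots> = r (pair_type n x y z)"
    using finite_triples pair_type_in_triples[OF assms] by simp
  finally show ?thesis .
qed

text \<open>Evaluating a vanishing combination at a pair that realizes \<open>t\<close> isolates the
  coefficient of the indicator of \<open>t\<close>.\<close>

lemma independent_triple_products:
  "mat.independent (fs_triple_products n U x :: (_ \<Rightarrow> _ \<Rightarrow> 'f::field) set)"
  unfolding fs_triple_products_eq
proof (rule mat.independent_if_scalars_zero)
  let ?I = "type_indicator n U x :: _ \<Rightarrow> _ \<Rightarrow> _ \<Rightarrow> 'f"
  show "finite (?I ` fs_triples n U)" using finite_triples by simp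
  fix r and M :: "(nat \<Rightarrow> 'u) \<Rightarrow> (nat \<Rightarrow> 'u) \<Rightarrow> 'f"
  assume zero: "(\<Sum>M\<in>?I ` fs_triples n U. mat_scale (r M) M) = 0"
    and "M \<in> ?I ` fs_triples n U"
  then obtain t where t: "t \<in> fs_triples n U" and M: "M = ?I t" by blast
  obtain y z where yz: "y \<in> X" "z \<in> X" "pair_type n x y z = t"
    using triples_realized[OF t] by blast
  have "(\<Sum>t\<in>fs_triples n U. mat_scale (r (?I t)) (?I t)) = 0"
    using zero by (simp add: sum.reindex[OF inj_on_type_indicator])
  then have "(\<Sum>t\<in>fs_triples n U. mat_scale (r (?I t)) (?I t)) y z = 0" by simp
  with yz show "r M = 0"
    by (simp add: sum_type_indicator_apply[of y z "\<lambda>t. r (?I t)"] M)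
qed

section \<open>The space of type-invariant matrices\<close>

lemma type_invariantD:
  assumes "M \<in> type_invariant n U x" "y \<in> X" "z \<in> X" "y' \<in> X" "z' \<in> X"
    "pair_type n x y z = pair_type n x y' z'"
  shows "M y z = M y' z'"
  using assms unfolding type_invariant_def by blast

lemma type_invariantI:
  assumes "M \<in> mat_carrier X"
    and "\<And>y z y' z'. y \<in> X \<Longrightarrow> z \<in> X \<Longrightarrow> y' \<in> X \<Longrightarrow> z' \<in> X \<Longrightarrow>
      pair_type n x y z = pair_type n x y' z' \<Longrightarrow> M y z = M y' z'"
  shows "M \<in> type_invariant n U x"
  using assms unfolding type_invariant_def by blast

lemma type_invariant_carrier: "M \<in> type_invariant n U x \<Longrightarrow> M \<in> mat_carrier X"
  unfolding type_invariant_def by blast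

lemma subspace_type_invariant:
  "mat.subspace (type_invariant n U x :: (_ \<Rightarrow> _ \<Rightarrow> 'f::field) set)"
proof -
  have carrier: "mat.subspace (mat_carrier X :: (_ \<Rightarrow> _ \<Rightarrow> 'f) set)"
    using mat_subalgebra_carrier unfolding mat_subalgebra_def by blast
  show ?thesis
    unfolding mat.subspace_def
  proof (intro conjI ballI allI)
    show "(0 :: _ \<Rightarrow> _ \<Rightarrow> 'f) \<in> type_invariant n U x"
      by (rule type_invariantI[OF mat.subspace_0[OF carrier]]) simp
    fix M N :: "(nat \<Rightarrow> 'u) \<Rightarrow> (nat \<Rightarrow> 'u) \<Rightarrow> 'f" and c
    assume M: "M \<in> type_invariant n U x"
    note Mc = type_invariant_carrier[OF M]
    show "mat_scale c M \<in> type_invariant n U x"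
    proof (rule type_invariantI[OF mat.subspace_scale[OF carrier Mc]])
      fix y z y' z' assume "y \<in> X" "z \<in> X" "y' \<in> X" "z' \<in> X"
        "pair_type n x y z = pair_type n x y' z'"
      then have "M y z = M y' z'" by (rule type_invariantD[OF M])
      then show "mat_scale c M y z = mat_scale c M y' z'" by (simp add: mat_scale_def)
    qed
    assume N: "N \<in> type_invariant n U x"
    show "M + N \<in> type_invariant n U x"
    proof (rule type_invariantI[OF mat.subspace_add[OF carrier Mc type_invariant_carrier[OF N]]])
      fix y z y' z' assume *: "y \<in> X" "z \<in> X" "y' \<in> X" "z' \<in> X"
        "pair_type n x y z = pair_type n x y' z'"
      show "(M + N) y z = (M + N) y' z'"
        using type_invariantD[OF M *] type_invariantD[OF N *] by simp
    qed
  qed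
qed

text \<open>Each indicator is type-invariant. Conversely, a type-invariant matrix is the combination
  of indicators whose coefficient at \<open>t\<close> is the common value of its entries of type
  \<open>t\<close>.\<close>

lemma span_triple_products:
  "mat.span (fs_triple_products n U x) = (type_invariant n U x :: (_ \<Rightarrow> _ \<Rightarrow> 'f::field) set)"
proof (rule subset_antisym)
  show "mat.span (fs_triple_products n U x) \<subseteq> type_invariant n U x"
    using subspace_type_invariant unfolding fs_triple_products_eq
    by (intro mat.span_minimal)
       (auto simp: type_invariant_def mat_carrier_def type_indicator_def)
  show "type_invariant n U x \<subseteq> (mat.span (fs_triple_products n U x) :: (_ \<Rightarrow> _ \<Rightarrow> 'f) set)"
  proof
    fix M :: "_ \<Rightarrow> _ \<Rightarrow> 'f" assume M: "M \<in> type_invariant n U x"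
    \<comment> \<open>The pair \<open>(f t, g t)\<close> is a chosen representative of the type
      \<open>t\<close>, at which the coefficient is read off.\<close>
    obtain f g where fg: "\<And>t. t \<in> fs_triples n U \<Longrightarrow>
        f t \<in> X \<and> g t \<in> X \<and> pair_type n x (f t) (g t) = t"
      using triples_realized by metis
    let ?N = "\<Sum>t\<in>fs_triples n U. mat_scale (M (f t) (g t)) (type_indicator n U x t)"
    have N: "?N \<in> mat.span (fs_triple_products n U x)"
      unfolding fs_triple_products_eq
      by (intro mat.span_sum mat.span_scale mat.span_base) auto
    have "?N \<in> type_invariant n U x"
      using N \<open>mat.span (fs_triple_products n U x) \<subseteq> type_invariant n U x\<close> by blast
    then have carrier: "M \<in> mat_carrier X" "?N \<in> mat_carrier X"
      using M by (simp_all add: type_invariant_def)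
    have "M = ?N"
    proof (intro ext)
      fix y z
      show "M y z = ?N y z"
      proof (cases "y \<in> X \<and> z \<in> X")
        case True
        let ?t = "pair_type n x y z"
        have "M y z = M (f ?t) (g ?t)"
          using True fg[OF pair_type_in_triples, of y z] by (intro type_invariantD[OF M]) auto
        with True show ?thesis
          by (simp add: sum_type_indicator_apply[of y z "\<lambda>t. M (f t) (g t)"])
      next
        case False
        have zero: "K y z = 0" if "K \<in> mat_carrier X" for K :: "_ \<Rightarrow> _ \<Rightarrow> 'f"
          using that False unfolding mat_carrier_def by blast
        show ?thesis by (simp only: zero[OF carrier(1)] zero[OF carrier(2)])
      qed
    qed
    with N show "M \<in> mat.span (fs_triple_products n U x)" by simp
  qed
qed

section \<open>Symmetries fixing the base point and closure under multiplication\<close>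

lemma type_preserving_bijection_exists:
  assumes "y \<in> X" "z \<in> X" "y' \<in> X" "z' \<in> X"
    and type: "pair_type n x y z = pair_type n x y' z'"
  shows "\<exists>s. bij_betw s X X \<and> s y = y' \<and> s z = z' \<and>
    (\<forall>v\<in>X. \<forall>w\<in>X. pair_type n x (s v) (s w) = pair_type n x v w)"
proof -
  \<comment> \<open>Equality of the two types gives, in each coordinate, the three equivalences
    required for a permutation that fixes \<open>x h\<close>.\<close>
  have "\<exists>f. bij_betw f (U h) (U h) \<and> f (x h) = x h \<and> f (y h) = y' h \<and> f (z h) = z' h"
    if "h \<in> {1..n}" for h
    using type that assms(1-4) base
    by (intro permutation_fixing_point_exists point_mem)
       (simp_all add: pair_type_def pattern_eq_iff)
  then obtain f where f: "\<And>h. h \<in> {1..n} \<Longrightarrow>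
      bij_betw (f h) (U h) (U h) \<and> f h (x h) = x h \<and> f h (y h) = y' h \<and> f h (z h) = z' h"
    by metis
  define s where "s = (\<lambda>w. \<lambda>h\<in>{1..n}. f h (w h))"
  have inj: "f h u = f h v \<longleftrightarrow> u = v" if "h \<in> {1..n}" "u \<in> U h" "v \<in> U h" for h u v
    using f[OF that(1)] that by (auto simp: bij_betw_def inj_on_def)
  have sX: "s w \<in> X" if "w \<in> X" for w
  proof -
    have "f h (w h) \<in> U h" if h: "h \<in> {1..n}" for h
      using f[OF h] point_mem[OF \<open>w \<in> X\<close> h] bij_betwE by blast
    then show ?thesis by (simp add: s_def fs_points_def)
  qed
  have "inj_on s X"
  proof (rule inj_onI)
    fix v w assume vw: "v \<in> X" "w \<in> X" "s v = s w"
    have "v h = w h" if h: "h \<in> {1..n}" for h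
      using fun_cong[OF vw(3), of h] h inj[OF h point_mem point_mem, OF vw(1) h vw(2) h]
      by (simp add: s_def)
    with vw show "v = w" by (simp add: fs_points_eq_iff)
  qed
  \<comment> \<open>An injective map of a finite set into itself is surjective.\<close>
  then have "bij_betw s X X"
    using sX finite_points by (intro bij_betw_imageI endo_inj_surj) auto
  moreover have "s y = y'" "s z = z'"
    unfolding fs_points_eq_iff[OF sX[OF assms(1)] assms(3)]
      fs_points_eq_iff[OF sX[OF assms(2)] assms(4)]
    using f by (simp_all add: s_def)
  moreover have "pair_type n x (s v) (s w) = pair_type n x v w" if vw: "v \<in> X" "w \<in> X" for v w
  proof -
    \<comment> \<open>As \<open>f h\<close> fixes \<open>x h\<close>, this compares the images of
      \<open>x h\<close> and \<open>u h\<close> under an injective map.\<close>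
    have "x h = s u h \<longleftrightarrow> x h = u h" if "h \<in> {1..n}" "u \<in> X" for h u
      using inj[OF that(1) point_mem point_mem, OF base that(1) that(2) that(1)] f[OF that(1)] that(1)
      by (simp add: s_def)
    moreover have "s v h = s w h \<longleftrightarrow> v h = w h" if "h \<in> {1..n}" for h
      using inj[OF that point_mem point_mem, OF vw(1) that vw(2) that] that by (simp add: s_def)
    ultimately show ?thesis using vw by (simp add: pair_type_def pattern_eq_iff)
  qed
  ultimately show ?thesis by blast
qed

text \<open>For pairs \<open>(y, z)\<close> and \<open>(y', z')\<close> of equal type, substitute
  \<open>s w\<close> for the summation index in the entry at \<open>(y', z')\<close>, where
  \<open>s\<close> is a type-preserving bijection carrying one pair to the other. Each factor then
  equals its counterpart in the entry at \<open>(y, z)\<close>.\<close>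

lemma mult_type_invariant:
  assumes M: "M \<in> type_invariant n U x" and N: "N \<in> type_invariant n U x"
  shows "mat_mult X M N \<in> type_invariant n U x"
proof -
  have "mat_mult X M N y z = mat_mult X M N y' z'"
    if mem: "y \<in> X" "z \<in> X" "y' \<in> X" "z' \<in> X"
      and eq: "pair_type n x y z = pair_type n x y' z'" for y z y' z'
  proof -
    obtain s where s: "bij_betw s X X" "s y = y'" "s z = z'"
      "\<And>v w. v \<in> X \<Longrightarrow> w \<in> X \<Longrightarrow> pair_type n x (s v) (s w) = pair_type n x v w"
      using type_preserving_bijection_exists[OF mem eq] by blast
    have sX: "s w \<in> X" if "w \<in> X" for w using s(1) that by (auto simp: bij_betw_def)
    have "mat_mult X M N y' z' = (\<Sum>w\<in>X. M (s y) (s w) * N (s w) (s z))"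
      unfolding mat_mult_def s(2,3) by (rule sum.reindex_bij_betw[OF s(1), symmetric])
    also have "\<dots> = (\<Sum>w\<in>X. M y w * N w z)"
      using mem s(4) sX
      by (intro sum.cong refl arg_cong2[of _ _ _ _ "(*)"] type_invariantD[OF M]
          type_invariantD[OF N]) auto
    finally show ?thesis by (simp add: mat_mult_def)
  qed
  moreover have "mat_mult X M N \<in> mat_carrier X"
    using M N by (auto simp: type_invariant_def mat_carrier_def mat_mult_def)
  ultimately show ?thesis unfolding type_invariant_def by blast
qed

text \<open>The middle component of the type records in which coordinates \<open>y\<close> and
  \<open>z\<close> differ. This makes diagonal matrices such as \<open>mat_one X\<close> and the
  dual idempotents accessible to type arguments.\<close>

lemma eq_iff_of_pair_type_eq:
  assumes "y \<in> X" "z \<in> X" "y' \<in> X" "z' \<in> X" "pair_type n x y z = pair_type n x y' z'"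
  shows "y = z \<longleftrightarrow> y' = z'"
  using assms by (simp add: fs_points_eq_iff pair_type_def pattern_eq_iff)

section \<open>Identification with the Terwilliger algebra\<close>

lemma subalgebra_type_invariant: "mat_subalgebra X (type_invariant n U x)"
  unfolding mat_subalgebra_def
proof (intro conjI ballI)
  show "mat_one X \<in> type_invariant n U x"
  proof (rule type_invariantI)
    show "mat_one X \<in> mat_carrier X" by (auto simp: mat_one_def mat_carrier_def)
    fix y z y' z' assume *: "y \<in> X" "z \<in> X" "y' \<in> X" "z' \<in> X"
      "pair_type n x y z = pair_type n x y' z'"
    show "mat_one X y z = mat_one X y' z'"
      using eq_iff_of_pair_type_eq[OF *] * by (auto simp: mat_one_def)
  qed
  show "type_invariant n U x \<subseteq> mat_carrier X"
    using type_invariant_carrier by blast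
qed (simp_all add: subspace_type_invariant mult_type_invariant)

text \<open>The entries of \<open>fs_adj n U g\<close> depend on the second component of the type,
  those of \<open>fs_dual_idem n U x g\<close> on the first component and on whether the pair is
  diagonal, so the generators are type-invariant. Conversely, the triple products are products of
  generators, and they span the type-invariant matrices.\<close>

lemma fs_terwilliger_eq_type_invariant:
  "fs_terwilliger n U x = (type_invariant n U x :: (_ \<Rightarrow> _ \<Rightarrow> 'f::field) set)"
proof (rule subset_antisym)
  have "fs_adj n U g \<in> type_invariant n U x" if "g \<in> fs_index n" for g
    using that by (auto simp: type_invariant_def mat_carrier_def fs_adj_def fs_rel_iff pair_type_def)
  moreover have "fs_dual_idem n U x g \<in> type_invariant n U x" if g: "g \<in> fs_index n" for g
  proof -
    have "fs_dual_idem n U x g y z = fs_dual_idem n U x g y' z'"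
      if *: "y \<in> X" "z \<in> X" "y' \<in> X" "z' \<in> X" "pair_type n x y z = pair_type n x y' z'"
      for y z y' z'
      using eq_iff_of_pair_type_eq[OF *] *
      by (simp add: fs_dual_idem_def fs_rel_iff[OF g] pair_type_def)
    moreover have "fs_dual_idem n U x g \<in> mat_carrier X"
      by (auto simp: mat_carrier_def fs_dual_idem_def fs_rel_iff[OF g])
    ultimately show ?thesis unfolding type_invariant_def by blast
  qed
  ultimately show "fs_terwilliger n U x \<subseteq> (type_invariant n U x :: (_ \<Rightarrow> _ \<Rightarrow> 'f) set)"
    unfolding fs_terwilliger_def
    by (intro hull_minimal subalgebra_type_invariant) auto
  \<comment> \<open>The hull is the intersection of all subalgebras containing the generators, so
    the span is placed in an arbitrary such \<open>T\<close>.\<close>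
  have "mat.span (fs_triple_products n U x) \<subseteq> T"
    if gen: "fs_adj n U ` fs_index n \<union> fs_dual_idem n U x ` fs_index n \<subseteq> T"
      and T: "mat_subalgebra X T" for T :: "(_ \<Rightarrow> _ \<Rightarrow> 'f) set"
  proof (rule mat.span_minimal)
    show "mat.subspace T" using T by (simp add: mat_subalgebra_def)
    have mult: "mat_mult X M N \<in> T" if "M \<in> T" "N \<in> T" for M N
      using T that by (simp add: mat_subalgebra_def)
    show "fs_triple_products n U x \<subseteq> T"
      unfolding fs_triple_products_def fs_triples_def using gen by (auto intro!: mult)
  qed
  then show "type_invariant n U x \<subseteq> (fs_terwilliger n U x :: (_ \<Rightarrow> _ \<Rightarrow> 'f) set)"
    unfolding fs_terwilliger_def hull_def span_triple_products by blast
qed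

lemma card_triple_products:
  "card (fs_triple_products n U x :: (_ \<Rightarrow> _ \<Rightarrow> 'f::field) set) = card (fs_triples n U)"
  unfolding fs_triple_products_eq by (rule card_image[OF inj_on_type_indicator])

end

theorem theorem3p5:
  fixes n :: nat and U :: "nat \<Rightarrow> 'u set" and x :: "nat \<Rightarrow> 'u"
    and n1 n2 :: nat
    and \<B> :: "((nat \<Rightarrow> 'u) \<Rightarrow> (nat \<Rightarrow> 'u) \<Rightarrow> 'f::field) set"
  assumes "n \<ge> 1"
    and "\<And>h. h \<in> {1..n} \<Longrightarrow> finite (U h) \<and> card (U h) \<ge> 2"
    and "x \<in> fs_points n U"
    and "n1 = card {a \<in> {1..n}. card (U a) = 2}"
    and "n2 = card {a \<in> {1..n}. card (U a) > 2}"
    and "\<B> = fs_triple_products n U x"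
  shows "mat_basis \<B> (fs_terwilliger n U x) \<and> card \<B> = 2 ^ (2 * n1) * 5 ^ n2"
proof -
  interpret pointed_factorial_scheme n U x
    using assms(2,3) by unfold_locales
  show ?thesis
    unfolding assms(4-6) mat_basis_def span_triple_products fs_terwilliger_eq_type_invariant
    by (simp only: independent_triple_products card_triple_products card_fs_triples assms(2)) simp
qed

end
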